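(* Let $\lambda_1$ be the missing digits measure on $\mathbb{R}$ with base $p=10^{10000}$ and digit set $\{1,2,\dots,10^{5005}\}$. Let $\lambda_2$ be the missing digits measure on $\mathbb{R}$ with base $p=11^{10000}$ and digit set $\{1,2,\dots,11^{5005}\}$. Then for Lebesgue almost all $\theta\in S^1$, the measures $P_\theta(\lambda_1\times\lambda_2)$ and $P_\theta(\lambda_1\times\lambda_1)$ are continuous functions, i.e. each is absolutely continuous with respect to Lebesgue measure on the line $H_\theta$ with a continuous density function.
   Context: Missing digits measure: for an integer $p\ge 3$ and a non-empty set $D\subset\{0,\dots,p-1\}$, the missing digits measure $\lambda_{p,D}$ with base $p$ and digit set $D$ is the Borel probability measure on $\mathbb{R}$ that is the distribution of the random sum $S=\sum_{i\ge 1}p^{-i}\mathbf{d}_i$, where the $\mathbf{d}_i$ are chosen independently and uniformly at random from $D$ (each element having probability $1/\#D$). Linear projection: for $\theta\in S^{n-1}$ let $H_\theta\subset\mathbb{R}^n$ be the $(n-1)$-dimensional linear subspace normal to $\theta$. The map $P_\theta:\mathbb{R}^n\to H_\theta$ sends $y$ to the unique $h_y\in H_\theta$ with $y\in h_y+\theta\mathbb{R}$ (the orthogonal projection onto $H_\theta$). For a Borel probability measure $\mu$ on $\mathbb{R}^n$, $P_\theta(\mu)$ denotes the push-forward of $\mu$ under $P_\theta$. Here $n=2$, and $\lambda_1\times\lambda_2$, $\lambda_1\times\lambda_1$ are product measures on $\mathbb{R}^2$. *)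

theory Defs
  imports "HOL-Probability.Probability"
begin

text \<open>The independent digits are the coordinates of the infinite product space; coordinate
  \<open>i\<close> is the digit with weight \<open>1 / p ^ Suc i\<close>.  The definition is meant for \<open>p \<ge> 3\<close> and
  non-empty \<open>D \<subseteq> {0..<p}\<close>; the series converges almost surely, namely wherever all
  coordinates lie in \<open>D\<close>.\<close>

definition missing_digits_measure :: "nat \<Rightarrow> nat set \<Rightarrow> real measure" where
  "missing_digits_measure p D =
     distr (\<Pi>\<^sub>M i\<in>(UNIV :: nat set). measure_pmf (pmf_of_set D)) borel
       (\<lambda>d. \<Sum>i. real (d i) / real p ^ Suc i)"

definition normal_hyperplane :: "'a::euclidean_space \<Rightarrow> 'a set" where
  "normal_hyperplane \<theta> = {h. h \<bullet> \<theta> = 0}"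

definition linear_proj :: "'a::euclidean_space \<Rightarrow> 'a \<Rightarrow> 'a" where
  "linear_proj \<theta> y = (THE h. h \<in> normal_hyperplane \<theta> \<and> (\<exists>t::real. y = h + t *\<^sub>R \<theta>))"

text \<open>The push-forward is a measure on the hyperplane itself, with its Borel sets.\<close>

definition proj_measure :: "'a::euclidean_space \<Rightarrow> 'a measure \<Rightarrow> 'a measure" where
  "proj_measure \<theta> \<mu> = distr \<mu> (restrict_space borel (normal_hyperplane \<theta>)) (linear_proj \<theta>)"

text \<open>For a unit vector \<open>\<theta>\<close> in the plane, \<open>(- snd \<theta>, fst \<theta>)\<close> is a unit vector spanning the
  line normal to \<open>\<theta>\<close>, so the parametrization below is an isometry of the reals onto it.\<close>

definition normal_line_lebesgue :: "real \<times> real \<Rightarrow> (real \<times> real) measure" where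
  "normal_line_lebesgue \<theta> =
     distr lborel (restrict_space borel (normal_hyperplane \<theta>)) (\<lambda>t. t *\<^sub>R (- snd \<theta>, fst \<theta>))"

text \<open>Arc length on the unit circle.  Every Lebesgue null set is contained in a Borel null
  set, so working with Borel sets does not affect the meaning of almost all.\<close>

definition circle_measure :: "(real \<times> real) measure" where
  "circle_measure =
     distr (restrict_space lborel {0..<2 * pi}) (restrict_space borel (sphere 0 1))
       (\<lambda>t. (cos t, sin t))"

definition has_continuous_density :: "'a::topological_space measure \<Rightarrow> 'a measure \<Rightarrow> bool" where
  "has_continuous_density M N \<longleftrightarrow>
     absolutely_continuous M N \<and>
     (\<exists>f :: 'a \<Rightarrow> real. continuous_on (space M) f \<and> (\<forall>x\<in>space M. 0 \<le> f x) \<and>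
        N = density M (\<lambda>x. ennreal (f x)))"

lemma linear_proj_eq:
  assumes "norm \<theta> = 1"
  shows "linear_proj \<theta> y = y - (y \<bullet> \<theta>) *\<^sub>R \<theta>"
proof -
  have 1: "\<theta> \<bullet> \<theta> = 1" using assms by (simp add: dot_square_norm)
  show ?thesis unfolding linear_proj_def
  proof (rule the_equality)
    show "y - (y \<bullet> \<theta>) *\<^sub>R \<theta> \<in> normal_hyperplane \<theta> \<and> (\<exists>t. y = y - (y \<bullet> \<theta>) *\<^sub>R \<theta> + t *\<^sub>R \<theta>)"
      using 1 by (auto simp: normal_hyperplane_def inner_diff_left intro!: exI[of _ "y \<bullet> \<theta>"])
  qed (use 1 in \<open>auto simp: normal_hyperplane_def inner_add_left\<close>)
qed

lemma linear_proj_measurable: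
  assumes "norm \<theta> = 1"
  shows "linear_proj \<theta> \<in> borel \<rightarrow>\<^sub>M restrict_space borel (normal_hyperplane \<theta>)"
proof (rule measurable_restrict_space2)
  have 1: "\<theta> \<bullet> \<theta> = 1" using assms by (simp add: dot_square_norm)
  show "linear_proj \<theta> \<in> space borel \<rightarrow> normal_hyperplane \<theta>"
    using 1 by (auto simp: linear_proj_eq[OF assms] normal_hyperplane_def inner_diff_left)
  have "linear_proj \<theta> = (\<lambda>y. y - (y \<bullet> \<theta>) *\<^sub>R \<theta>)"
    by (intro ext linear_proj_eq assms)
  then show "linear_proj \<theta> \<in> borel \<rightarrow>\<^sub>M borel" by simp
qed

lemma normal_line_param_measurable:
  "(\<lambda>t. t *\<^sub>R (- snd \<theta>, fst \<theta>)) \<in>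
     lborel \<rightarrow>\<^sub>M restrict_space borel (normal_hyperplane (\<theta> :: real \<times> real))"
proof (rule measurable_restrict_space2)
  show "(\<lambda>t. t *\<^sub>R (- snd \<theta>, fst \<theta>)) \<in> space lborel \<rightarrow> normal_hyperplane \<theta>"
    by (cases \<theta>) (auto simp: normal_hyperplane_def inner_prod_def)
  show "(\<lambda>t. t *\<^sub>R (- snd \<theta>, fst \<theta>)) \<in> lborel \<rightarrow>\<^sub>M borel"
    by (simp add: borel_measurable_continuous_onI continuous_intros)
qed

lemma circle_param_measurable:
  "(\<lambda>t. (cos t, sin t)) \<in>
     restrict_space lborel {0..<2 * pi} \<rightarrow>\<^sub>M restrict_space borel (sphere 0 (1::real))"
proof (rule measurable_restrict_space2)
  show "(\<lambda>t. (cos t, sin t)) \<in> space (restrict_space lborel {0..<2 * pi}) \<rightarrow> sphere 0 (1::real)"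
    by (auto simp: norm_Pair)
  have "(\<lambda>t::real. (cos t, sin t)) \<in> borel \<rightarrow>\<^sub>M borel"
    by (intro borel_measurable_continuous_onI continuous_intros)
  then show "(\<lambda>t. (cos t, sin t :: real)) \<in> restrict_space lborel {0..<2 * pi} \<rightarrow>\<^sub>M borel"
    by (intro measurable_restrict_space1) simp
qed

lemma digit_sum_measurable:
  "(\<lambda>d. \<Sum>i. real (d i) / real p ^ Suc i) \<in>
     borel_measurable (\<Pi>\<^sub>M i\<in>(UNIV :: nat set). measure_pmf (pmf_of_set (D :: nat set)))"
proof (rule borel_measurable_suminf)
  fix i :: nat
  have "(\<lambda>d. d i) \<in> (\<Pi>\<^sub>M i\<in>(UNIV :: nat set). measure_pmf (pmf_of_set D)) \<rightarrow>\<^sub>M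
      measure_pmf (pmf_of_set D)"
    by (rule measurable_component_singleton) simp
  then have "(\<lambda>d. (\<lambda>k. real k / real p ^ Suc i) (d i)) \<in>
      borel_measurable (\<Pi>\<^sub>M i\<in>(UNIV :: nat set). measure_pmf (pmf_of_set D))"
    by (rule measurable_compose) simp
  then show "(\<lambda>d. real (d i) / real p ^ Suc i) \<in>
      borel_measurable (\<Pi>\<^sub>M i\<in>(UNIV :: nat set). measure_pmf (pmf_of_set D))"
    by simp
qed

lemma prob_space_missing_digits_measure: "prob_space (missing_digits_measure p D)"
proof -
  interpret product_prob_space "\<lambda>_::nat. measure_pmf (pmf_of_set D)" UNIV
    by unfold_locales
  show ?thesis
    unfolding missing_digits_measure_def by (rule prob_space_distr[OF digit_sum_measurable])
qed

end

theory Submission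
  imports Defs
begin

text \<open>
  A probability measure on the line whose characteristic function is integrable has a continuous
  density, by Fourier inversion.  In the normal coordinate of \<open>H\<^sub>\<theta>\<close>, the projection of
  \<open>\<mu> \<times> \<nu>\<close> has characteristic function \<open>t \<mapsto> \<phi> (- t sin \<tau>) * \<psi> (t cos \<tau>)\<close>, where \<open>\<theta> = (cos \<tau>, sin \<tau>)\<close>
  and \<open>\<phi>\<close>, \<open>\<psi>\<close> are the characteristic functions of \<open>\<mu>\<close> and \<open>\<nu>\<close>.  So it suffices that this
  product is integrable in \<open>t\<close> for almost every \<open>\<tau>\<close>.  In terms of the slope \<open>a = - tan \<tau>\<close> the
  integral is a multiple of \<open>\<integral> \<bar>\<phi> (a u) * \<psi> u\<bar> du\<close>; integrating it over \<open>\<bar>a\<bar> \<le> K\<close> and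
  substituting \<open>v = a u\<close> yields \<open>\<integral>\<integral> \<bar>\<phi> v * \<psi> u\<bar> / \<bar>u\<bar> dv du\<close> over \<open>\<bar>v\<bar> \<le> K \<bar>u\<bar>\<close>, where
  \<open>1 / \<bar>u\<bar> \<le> sqrt (K / (\<bar>u\<bar> \<bar>v\<bar>))\<close>.  The variables separate, and everything reduces to the
  one-dimensional condition \<open>\<integral> \<bar>\<phi> t\<bar> / sqrt \<bar>t\<bar> dt < \<infinity>\<close> on each factor.

  For the missing digits measure with base \<open>p\<close> and digits \<open>{1..N}\<close>, splitting off the first digit
  gives \<open>\<phi> t = g (t / p) * \<phi> (t / p)\<close>, where \<open>g\<close> is the \<open>2\<pi>\<close>-periodic mean of the \<open>exp (i d s)\<close>
  over the digits \<open>d\<close>.  Iterating this along the residues modulo \<open>p\<close> shows that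
  \<open>\<Sum>k<p^n. \<bar>\<phi> (y + 2\<pi>k)\<bar> \<le> S^n\<close> for \<open>y\<close> in \<open>[0, 2\<pi>)\<close>, where \<open>S\<close> bounds the sums
  \<open>\<Sum>k<p. \<bar>g ((y + 2\<pi>k) / p)\<bar>\<close>.  Hence \<open>\<bar>\<phi>\<bar>\<close> has integral at most \<open>2\<pi>S^n\<close> over \<open>[0, 2\<pi>p^n)\<close>,
  and the weighted integral is dominated by a geometric series of ratio \<open>S / sqrt p\<close>.  Because the
  digits are consecutive, \<open>g\<close> is a Dirichlet kernel, and comparison with the harmonic series gives
  \<open>S = 2 + (p / N) (1 + ln p)\<close>.  For \<open>p = b^10000\<close> and \<open>N = b^5005\<close> with \<open>b \<ge> 10\<close> this is less than
  \<open>b^5000 = sqrt p\<close>: the logarithmic loss, at most \<open>10000 (b - 1) \<le> b^5 - b^4\<close>, is absorbed by the five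
  spare powers of \<open>b\<close>.
\<close>

section \<open>Fourier inversion\<close>

text \<open>The inverse Fourier transform, normalised for \<open>char\<close>.\<close>

definition fourier_density :: "(real \<Rightarrow> complex) \<Rightarrow> real \<Rightarrow> complex" where
  "fourier_density \<phi> x = 1 / (2 * pi) * (CLBINT t. iexp (- (t * x)) * \<phi> t)"

lemma norm_fourier_density_le:
  "norm (fourier_density \<phi> x) \<le> 1 / (2 * pi) * (LBINT t. norm (\<phi> t))"
proof -
  have "norm (CLBINT t. iexp (- (t * x)) * \<phi> t) \<le> (LBINT t. norm (iexp (- (t * x)) * \<phi> t))"
    by (rule integral_norm_bound)
  also have "\<dots> = (LBINT t. norm (\<phi> t))"
    by (simp add: norm_mult del: of_real_mult of_real_minus)
  finally show ?thesis
    by (simp add: fourier_density_def norm_mult norm_divide divide_right_mono)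
qed

lemma continuous_fourier_density:
  assumes \<phi>: "integrable lborel \<phi>"
  shows "continuous_on UNIV (fourier_density \<phi>)"
proof (rule continuous_at_imp_continuous_on, intro ballI)
  have [measurable]: "\<phi> \<in> borel_measurable borel" using \<phi> by auto
  fix x :: real
  show "isCont (fourier_density \<phi>) x"
    unfolding continuous_at_sequentially
  proof safe
    fix X assume X: "X \<longlonglongrightarrow> x"
    have "(\<lambda>n. CLBINT t. iexp (- (t * X n)) * \<phi> t) \<longlonglongrightarrow> (CLBINT t. iexp (- (t * x)) * \<phi> t)"
    proof (rule integral_dominated_convergence[where w="\<lambda>t. norm (\<phi> t)"])
      show "integrable lborel (\<lambda>t. norm (\<phi> t))" using \<phi> by auto
    qed (auto intro!: tendsto_intros X simp: norm_mult simp del: of_real_mult of_real_minus)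
    then show "(fourier_density \<phi> \<circ> X) \<longlonglongrightarrow> fourier_density \<phi> x"
      unfolding comp_def fourier_density_def by (intro tendsto_intros)
  qed
qed

lemma integral_iexp_Icc:
  fixes a b t :: real
  assumes "a \<le> b" "t \<noteq> 0"
  shows "(CLBINT x. indicator {a..b} x *\<^sub>R iexp (- (t * x))) = (iexp (- (t * a)) - iexp (- (t * b))) / (\<i> * t)"
proof -
  have "(CLBINT x. indicator {a..b} x *\<^sub>R iexp (- (t * x))) =
      (\<lambda>x. iexp (- (t * x)) / (- (\<i> * t))) b - (\<lambda>x. iexp (- (t * x)) / (- (\<i> * t))) a"
  proof (rule integral_FTC_Icc[OF assms(1)])
    fix x :: real
    have "((\<lambda>z. exp (- (\<i> * t * z)) / (- (\<i> * t))) has_field_derivative exp (- (\<i> * t * x)))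
        (at (of_real x))"
      using assms(2) by (auto intro!: derivative_eq_intros)
    then show "((\<lambda>x. iexp (- (t * x)) / (- (\<i> * t))) has_vector_derivative iexp (- (t * x)))
        (at x within {a..b})"
      using has_vector_derivative_real_field by (fastforce simp: algebra_simps)
  qed (intro continuous_intros)
  also have "\<dots> = (iexp (- (t * a)) - iexp (- (t * b))) / (\<i> * t)"
    using assms by (simp add: field_simps)
  finally show ?thesis .
qed

text \<open>In the Levy inversion formula the kernel is the integral of \<open>iexp (- (t * x))\<close> over the interval,
  and it is bounded by the length of the interval.  Integrability of the characteristic function
  therefore permits passing to the limit of the truncated integrals, by dominated convergence, and
  exchanging the integrals over \<open>t\<close> and \<open>x\<close>.\<close>

lemma (in real_distribution) measure_Ioc_eq_integral_fourier_density:
  assumes \<phi>: "integrable lborel (char M)" and ab: "a \<le> b"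
    and atoms: "measure M {a} = 0" "measure M {b} = 0"
  shows "complex_of_real (measure M {a<..b}) =
    (CLBINT x. indicator {a..b} x *\<^sub>R fourier_density (char M) x)"
proof -
  let ?\<phi> = "char M"
  let ?F = "\<lambda>t. (iexp (- (t * a)) - iexp (- (t * b))) / (\<i> * t)"
  have bound: "norm (?F t) \<le> b - a" for t
  proof (cases "t = 0")
    case False
    have "norm (?F t) = norm ((iexp ((-t) * b) - iexp ((-t) * a)) / (\<i> * (-t)))"
      using False by (simp add: norm_divide norm_mult norm_minus_commute)
    also have "\<dots> \<le> b - a"
      using Levy_Inversion_aux2[of a b "-t"] False ab by simp
    finally show ?thesis .
  qed (use ab in auto)
  have lim1: "(\<lambda>n::nat. 1 / (2 * pi) * (CLBINT t=-(real n)..real n. ?F t * ?\<phi> t)) \<longlonglongrightarrow>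
      complex_of_real (measure M {a<..b})"
    using Levy_Inversion[OF ab atoms] by simp
  have "(\<lambda>n::nat. CLBINT t. indicator {-real n<..<real n} t *\<^sub>R (?F t * ?\<phi> t)) \<longlonglongrightarrow>
      (CLBINT t. ?F t * ?\<phi> t)"
  proof (rule integral_dominated_convergence[where w="\<lambda>t. (b - a) * norm (?\<phi> t)"])
    show "integrable lborel (\<lambda>t. (b - a) * norm (?\<phi> t))" using \<phi> by auto
    show "AE t in lborel. (\<lambda>n. indicator {-real n<..<real n} t *\<^sub>R (?F t * ?\<phi> t)) \<longlonglongrightarrow> ?F t * ?\<phi> t"
    proof (rule AE_I2)
      fix t :: real
      obtain m :: nat where m: "\<bar>t\<bar> < real m" using reals_Archimedean2 by blast
      have "eventually (\<lambda>n. indicator {-real n<..<real n} t *\<^sub>R (?F t * ?\<phi> t) = ?F t * ?\<phi> t) sequentially"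
        using eventually_ge_at_top[of m]
      proof eventually_elim
        case (elim n)
        then have "t \<in> {-real n<..<real n}" using m by auto
        then show ?case by simp
      qed
      then show "(\<lambda>n. indicator {-real n<..<real n} t *\<^sub>R (?F t * ?\<phi> t)) \<longlonglongrightarrow> ?F t * ?\<phi> t"
        by (rule tendsto_eventually)
    qed
    show "AE t in lborel. norm (indicator {-real n<..<real n} t *\<^sub>R (?F t * ?\<phi> t)) \<le> (b - a) * norm (?\<phi> t)"
      for n
    proof (rule AE_I2)
      fix t :: real
      have "norm (?F t * ?\<phi> t) \<le> (b - a) * norm (?\<phi> t)"
        unfolding norm_mult by (intro mult_right_mono bound norm_ge_zero)
      then show "norm (indicator {-real n<..<real n} t *\<^sub>R (?F t * ?\<phi> t)) \<le> (b - a) * norm (?\<phi> t)"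
        unfolding norm_scaleR using ab by (cases "t \<in> {-real n<..<real n}") simp_all
    qed
  qed auto
  then have "(\<lambda>n::nat. CLBINT t=-(real n)..real n. ?F t * ?\<phi> t) \<longlonglongrightarrow> (CLBINT t. ?F t * ?\<phi> t)"
    by (simp add: interval_lebesgue_integral_def set_lebesgue_integral_def)
  then have "(\<lambda>n::nat. 1 / (2 * pi) * (CLBINT t=-(real n)..real n. ?F t * ?\<phi> t)) \<longlonglongrightarrow>
      1 / (2 * pi) * (CLBINT t. ?F t * ?\<phi> t)"
    by (intro tendsto_intros)
  then have "complex_of_real (measure M {a<..b}) = 1 / (2 * pi) * (CLBINT t. ?F t * ?\<phi> t)"
    using lim1 LIMSEQ_unique by blast
  also have "(CLBINT t. ?F t * ?\<phi> t) =
      (CLBINT t. (CLBINT x. indicator {a..b} x *\<^sub>R (iexp (- (t * x)) * ?\<phi> t)))"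
  proof (rule integral_cong_AE)
    have "AE t in lborel. t \<noteq> (0::real)" by (rule AE_lborel_singleton)
    then show "AE t in lborel. ?F t * ?\<phi> t = (CLBINT x. indicator {a..b} x *\<^sub>R (iexp (- (t * x)) * ?\<phi> t))"
    proof eventually_elim
      case (elim t)
      have "(CLBINT x. indicator {a..b} x *\<^sub>R (iexp (- (t * x)) * ?\<phi> t)) =
          (CLBINT x. indicator {a..b} x *\<^sub>R iexp (- (t * x)) * ?\<phi> t)" by simp
      also have "\<dots> = (CLBINT x. indicator {a..b} x *\<^sub>R iexp (- (t * x))) * ?\<phi> t"
        by (rule integral_mult_left_zero)
      also note integral_iexp_Icc[OF ab elim]
      finally show ?case by simp
    qed
  qed auto
  also have "\<dots> = (CLBINT x. (CLBINT t. indicator {a..b} x *\<^sub>R (iexp (- (t * x)) * ?\<phi> t)))"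
  proof (rule lborel_pair.Fubini_integral)
    show "integrable (lborel \<Otimes>\<^sub>M lborel) (\<lambda>(x, t). indicator {a..b} x *\<^sub>R (iexp (- (t * x)) * ?\<phi> t))"
    proof (rule lborel_pair.Fubini_integrable)
      have "(\<lambda>x. LBINT t. norm (case (x, t) of (x, t) \<Rightarrow> indicator {a..b} x *\<^sub>R (iexp (- (t * x)) * ?\<phi> t))) =
          (\<lambda>x. indicator {a..b} x * (LBINT t. norm (?\<phi> t)))"
        by (auto simp: norm_mult fun_eq_iff simp del: of_real_mult of_real_minus)
      then show "integrable lborel (\<lambda>x. LBINT t. norm (case (x, t) of (x, t) \<Rightarrow>
          indicator {a..b} x *\<^sub>R (iexp (- (t * x)) * ?\<phi> t)))"
        by (simp add: emeasure_lborel_Icc_eq)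
      show "AE x in lborel. integrable lborel (\<lambda>t. case (x, t) of (x, t) \<Rightarrow>
          indicator {a..b} x *\<^sub>R (iexp (- (t * x)) * ?\<phi> t))"
      proof (rule AE_I2)
        fix x :: real
        have "integrable lborel (\<lambda>t. iexp (- (t * x)) * ?\<phi> t)"
          using \<phi> by (rule Bochner_Integration.integrable_bound)
            (auto simp: norm_mult simp del: of_real_mult of_real_minus)
        then show "integrable lborel (\<lambda>t. case (x, t) of (x, t) \<Rightarrow>
            indicator {a..b} x *\<^sub>R (iexp (- (t * x)) * ?\<phi> t))"
          by simp
      qed
    qed auto
  qed
  finally have "complex_of_real (measure M {a<..b}) = 1 / (2 * pi) *
    (CLBINT x. (CLBINT t. indicator {a..b} x *\<^sub>R (iexp (- (t * x)) * ?\<phi> t)))" .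
  also have "\<dots> = (CLBINT x. indicator {a..b} x *\<^sub>R fourier_density ?\<phi> x)"
    unfolding fourier_density_def by (simp flip: integral_mult_right_zero) 
  finally show ?thesis .
qed

lemma (in real_distribution) exists_non_atom:
  assumes "u < v"
  obtains c where "u < c" "c < v" "measure M {c} = 0"
  using open_minus_countable[OF countable_support, of "{u<..<v}"] assms by force

lemma (in real_distribution) measure_Ioc_eq_integral_Re_fourier_density:
  assumes \<phi>: "integrable lborel (char M)" and ab: "a \<le> b"
    and atoms: "measure M {a} = 0" "measure M {b} = 0"
  shows "measure M {a<..b} = (LBINT x:{a..b}. Re (fourier_density (char M) x))"
proof -
  have "integrable lborel (\<lambda>x. indicator {a..b} x *\<^sub>R fourier_density (char M) x)"
    by (rule borel_integrable_compact)
      (auto intro: continuous_on_subset[OF continuous_fourier_density[OF \<phi>]])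
  then show ?thesis
    using arg_cong[OF measure_Ioc_eq_integral_fourier_density[OF assms], of Re]
    by (simp add: set_lebesgue_integral_def flip: integral_Re)
qed

text \<open>An atom would have to survive in arbitrarily short intervals around it with non-atomic end
  points, but the mass of those is at most a constant times their length.\<close>

lemma (in real_distribution) no_atoms:
  assumes \<phi>: "integrable lborel (char M)"
  shows "measure M {x} = 0"
proof -
  define C where "C = 1 / (2 * pi) * (LBINT t. norm (char M t))"
  have "measure M {x} \<le> e" if e: "e > 0" for e
  proof -
    have C: "0 \<le> C" unfolding C_def by simp
    define d where "d = e / (2 * (C + 1))"
    have d: "0 < d" "2 * d * C \<le> e" using e C by (auto simp: d_def field_simps)
    obtain a where a: "x - d < a" "a < x" "measure M {a} = 0" using d exists_non_atom[of "x - d" x] by auto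
    obtain b where b: "x < b" "b < x + d" "measure M {b} = 0" using d exists_non_atom[of x "x + d"] by auto
    have "measure M {x} \<le> measure M {a<..b}" using a b by (intro finite_measure_mono) auto
    also have "\<dots> = (LBINT y:{a..b}. Re (fourier_density (char M) y))"
      using a b by (intro measure_Ioc_eq_integral_Re_fourier_density[OF \<phi>]) auto
    also have "\<dots> \<le> (LBINT y:{a..b}. C)"
    proof (rule set_integral_mono)
      show "set_integrable lborel {a..b} (\<lambda>y. Re (fourier_density (char M) y))"
        unfolding set_integrable_def
        by (rule borel_integrable_compact)
          (auto intro!: continuous_intros continuous_on_subset[OF continuous_fourier_density[OF \<phi>]])
      show "set_integrable lborel {a..b} (\<lambda>y. C)" by (simp add: set_integrable_def emeasure_lborel_Icc_eq)
      show "Re (fourier_density (char M) y) \<le> C" for y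
        using norm_fourier_density_le[of "char M" y] complex_Re_le_cmod order_trans unfolding C_def by blast
    qed
    also have "\<dots> = (b - a) * C" using a b by (simp add: set_lebesgue_integral_def)
    also have "\<dots> \<le> (2 * d) * C" using a b C by (intro mult_right_mono) auto
    finally show ?thesis using d by linarith
  qed
  then have "measure M {x} \<le> 0" by (rule field_le_epsilon[where y=0, simplified])
  then show ?thesis by (simp add: measure_le_0_iff)
qed

text \<open>In the absence of atoms the inversion formula holds on every interval.  At a point where the
  inverse transform had negative real part, it would by continuity make a short interval have
  negative mass.\<close>

theorem (in real_distribution) continuous_density_if_integrable_char:
  assumes \<phi>: "integrable lborel (char M)"
  obtains f :: "real \<Rightarrow> real"
    where "continuous_on UNIV f" "\<And>x. 0 \<le> f x" "M = density lborel (\<lambda>x. ennreal (f x))"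
proof -
  define f where "f x = Re (fourier_density (char M) x)" for x
  have cont: "continuous_on UNIV f"
    unfolding f_def by (intro continuous_intros continuous_fourier_density \<phi>)
  then have [measurable]: "f \<in> borel_measurable borel" by (rule borel_measurable_continuous_onI)
  have int: "set_integrable lborel {a..b} f" for a b
    unfolding set_integrable_def
    by (rule borel_integrable_compact) (auto intro: continuous_on_subset[OF cont])
  have Ioc: "measure M {a<..b} = (LBINT x:{a..b}. f x)" if "a \<le> b" for a b
    unfolding f_def using that
    by (intro measure_Ioc_eq_integral_Re_fourier_density no_atoms \<phi>)
  have nonneg: "0 \<le> f x" for x
  proof (rule ccontr)
    assume neg: "\<not> 0 \<le> f x"
    then have "eventually (\<lambda>y. f y < f x / 2) (at x)"
      using cont by (intro order_tendstoD(2)[of f "f x"]) (auto simp: continuous_on_def)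
    then obtain d where d: "d > 0" "\<And>y. y \<noteq> x \<Longrightarrow> dist y x < d \<Longrightarrow> f y < f x / 2"
      unfolding eventually_at by auto
    have le: "f y \<le> f x / 2" if "y \<in> {x..x + d / 2}" for y
      using d(2)[of y] neg d(1) that by (cases "y = x") (auto simp: dist_real_def)
    have "measure M {x<..x + d / 2} = (LBINT y:{x..x + d / 2}. f y)"
      using d by (intro Ioc) auto
    also have "\<dots> \<le> (LBINT y:{x..x + d / 2}. f x / 2)"
      by (intro set_integral_mono int le) (auto simp: set_integrable_def emeasure_lborel_Icc_eq)
    also have "\<dots> < 0" using d(1) neg by (simp add: set_lebesgue_integral_def mult_neg_pos mult_pos_neg)
    finally show False using measure_nonneg[of M "{x<..x + d / 2}"] by linarith
  qed
  have "M = density lborel (\<lambda>x. ennreal (f x))"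
  proof (rule measure_eqI_lessThan)
    fix x :: real
    let ?N = "density lborel (\<lambda>x. ennreal (f x))"
    have eq: "emeasure M {x<..x + real n} = emeasure ?N {x<..x + real n}" for n
    proof -
      have "emeasure ?N {x<..x + real n} = (\<integral>\<^sup>+y. ennreal (f y) * indicator {x<..x + real n} y \<partial>lborel)"
        by (subst emeasure_density) auto
      also have "\<dots> = (\<integral>\<^sup>+y. ennreal (indicator {x..x + real n} y *\<^sub>R f y) \<partial>lborel)"
        using AE_lborel_singleton[of x]
        by (intro nn_integral_cong_AE) (auto split: split_indicator)
      also have "\<dots> = ennreal (LBINT y:{x..x + real n}. f y)"
        unfolding set_lebesgue_integral_def
        by (intro nn_integral_eq_integral int[unfolded set_integrable_def]) (auto simp: nonneg)
      also have "\<dots> = emeasure M {x<..x + real n}"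
        by (simp add: Ioc emeasure_eq_measure)
      finally show ?thesis ..
    qed
    have un: "{x<..} = (\<Union>n. {x<..x + real n})"
    proof (intro set_eqI iffI)
      fix y assume "y \<in> {x<..}"
      moreover obtain n where "y - x \<le> real n" using real_arch_simple by blast
      ultimately show "y \<in> (\<Union>n. {x<..x + real n})" by (auto simp: algebra_simps)
    qed auto
    have inc: "incseq (\<lambda>n. {x<..x + real n})" by (auto simp: incseq_def)
    have "emeasure M {x<..} = (SUP n. emeasure M {x<..x + real n})"
      unfolding un by (rule SUP_emeasure_incseq[symmetric]) (use inc in auto)
    also have "\<dots> = (SUP n. emeasure ?N {x<..x + real n})" by (simp only: eq)
    also have "\<dots> = emeasure ?N {x<..}"
      unfolding un by (rule SUP_emeasure_incseq) (use inc in auto)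
    finally show "emeasure M {x<..} = emeasure ?N {x<..}" .
  qed (auto simp: less_top[symmetric])
  with cont nonneg show ?thesis by (rule that)
qed

section \<open>Integrability along almost every direction\<close>

lemma nn_integral_dilation:
  fixes f :: "real \<Rightarrow> ennreal"
  assumes [measurable]: "f \<in> borel_measurable borel" and "c \<noteq> 0"
  shows "(\<integral>\<^sup>+x. f (c * x) \<partial>lborel) = ennreal (1 / \<bar>c\<bar>) * (\<integral>\<^sup>+x. f x \<partial>lborel)"
proof -
  have "(\<integral>\<^sup>+x. f x \<partial>lborel) = ennreal \<bar>c\<bar> * (\<integral>\<^sup>+x. f (c * x) \<partial>lborel)"
    using nn_integral_real_affine[of f c 0] assms by simp
  moreover have "ennreal (1 / \<bar>c\<bar>) * (ennreal \<bar>c\<bar> * y) = y" for y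
    using assms(2) by (simp add: mult.assoc[symmetric] flip: ennreal_mult)
  ultimately show ?thesis by simp
qed

text \<open>The integral is finite even after integration over the slopes \<open>\<bar>a\<bar> \<le> K\<close>: on this range
  \<open>1 \<le> sqrt (K * \<bar>u\<bar>) / sqrt \<bar>u * a\<bar>\<close>, which turns the inner integral over \<open>a\<close> into the weighted
  integral of \<open>f\<close> and leaves the weight \<open>1 / sqrt \<bar>u\<bar>\<close> for \<open>g\<close>.\<close>

lemma AE_slope_nn_integral_finite:
  fixes f g :: "real \<Rightarrow> ennreal"
  assumes [measurable]: "f \<in> borel_measurable borel" "g \<in> borel_measurable borel"
    and f: "(\<integral>\<^sup>+v. f v * ennreal (1 / sqrt \<bar>v\<bar>) \<partial>lborel) < \<infinity>"
    and g: "(\<integral>\<^sup>+u. g u * ennreal (1 / sqrt \<bar>u\<bar>) \<partial>lborel) < \<infinity>"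
  shows "AE a in lborel. (\<integral>\<^sup>+u. f (a * u) * g u \<partial>lborel) < \<infinity>"
proof -
  let ?w = "\<lambda>u. ennreal (1 / sqrt \<bar>u\<bar>)"
  have box: "AE a in lborel. \<bar>a\<bar> \<le> real K \<longrightarrow> (\<integral>\<^sup>+u. f (a * u) * g u \<partial>lborel) < \<infinity>" for K :: nat
  proof -
    have "(\<integral>\<^sup>+a. indicator {a. \<bar>a\<bar> \<le> real K} a * (\<integral>\<^sup>+u. f (a * u) * g u \<partial>lborel) \<partial>lborel) =
        (\<integral>\<^sup>+a. (\<integral>\<^sup>+u. indicator {a. \<bar>a\<bar> \<le> real K} a * (f (a * u) * g u) \<partial>lborel) \<partial>lborel)"
      by (intro nn_integral_cong nn_integral_cmult[symmetric]) measurable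
    also have "\<dots> = (\<integral>\<^sup>+u. (\<integral>\<^sup>+a. indicator {a. \<bar>a\<bar> \<le> real K} a * (f (a * u) * g u) \<partial>lborel) \<partial>lborel)"
      by (rule lborel_pair.Fubini') measurable
    also have "\<dots> \<le> (\<integral>\<^sup>+u. ennreal (sqrt K) * (\<integral>\<^sup>+v. f v * ?w v \<partial>lborel) * (g u * ?w u) \<partial>lborel)"
    proof (rule nn_integral_mono_AE)
      have "AE u in lborel. u \<noteq> (0::real)" by (rule AE_lborel_singleton)
      then show "AE u in lborel.
          (\<integral>\<^sup>+a. indicator {a. \<bar>a\<bar> \<le> real K} a * (f (a * u) * g u) \<partial>lborel)
          \<le> ennreal (sqrt K) * (\<integral>\<^sup>+v. f v * ?w v \<partial>lborel) * (g u * ?w u)"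
      proof eventually_elim
        case (elim u)
        have "(\<integral>\<^sup>+a. indicator {a. \<bar>a\<bar> \<le> real K} a * (f (a * u) * g u) \<partial>lborel)
          \<le> (\<integral>\<^sup>+a. ennreal (sqrt (K * \<bar>u\<bar>)) * g u * (f (u * a) * ?w (u * a)) \<partial>lborel)"
        proof (rule nn_integral_mono_AE)
          have "AE a in lborel. a \<noteq> (0::real)" by (rule AE_lborel_singleton)
          then show "AE a in lborel. indicator {a. \<bar>a\<bar> \<le> real K} a * (f (a * u) * g u) \<le>
              ennreal (sqrt (K * \<bar>u\<bar>)) * g u * (f (u * a) * ?w (u * a))"
          proof eventually_elim
            case (elim a)
            show ?case
            proof (cases "\<bar>a\<bar> \<le> real K")
              case True
              have "1 \<le> sqrt (K * \<bar>u\<bar>) * (1 / sqrt \<bar>u * a\<bar>)"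
                using True elim \<open>u \<noteq> 0\<close>
                by (simp add: real_sqrt_mult[symmetric] abs_mult real_sqrt_divide[symmetric] field_simps)
              then have "1 \<le> ennreal (sqrt (K * \<bar>u\<bar>)) * ?w (u * a)"
                by (simp flip: ennreal_mult)
              then have "1 * (f (u * a) * g u) \<le> ennreal (sqrt (K * \<bar>u\<bar>)) * ?w (u * a) * (f (u * a) * g u)"
                by (rule mult_right_mono) simp
              then show ?thesis using True by (simp add: mult_ac)
            qed simp
          qed
        qed
        also have "\<dots> = ennreal (sqrt (K * \<bar>u\<bar>)) * g u * (\<integral>\<^sup>+a. f (u * a) * ?w (u * a) \<partial>lborel)"
          by (rule nn_integral_cmult) measurable
        also have "(\<integral>\<^sup>+a. f (u * a) * ?w (u * a) \<partial>lborel) = ennreal (1 / \<bar>u\<bar>) * (\<integral>\<^sup>+v. f v * ?w v \<partial>lborel)"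
          using elim by (intro nn_integral_dilation) measurable
        also have "ennreal (sqrt (K * \<bar>u\<bar>)) * g u * \<dots> =
            (ennreal (sqrt (K * \<bar>u\<bar>)) * ennreal (1 / \<bar>u\<bar>)) * (\<integral>\<^sup>+v. f v * ?w v \<partial>lborel) * g u"
          by (simp only: mult_ac)
        also have "ennreal (sqrt (K * \<bar>u\<bar>)) * ennreal (1 / \<bar>u\<bar>) = ennreal (sqrt K) * ?w u"
        proof -
          have "sqrt (K * \<bar>u\<bar>) * (1 / \<bar>u\<bar>) = sqrt K * (1 / sqrt \<bar>u\<bar>)"
            using elim by (simp add: real_sqrt_mult field_simps)
          then show ?thesis by (simp flip: ennreal_mult)
        qed
        finally show ?case by (simp add: mult_ac)
      qed
    qed
    also have "\<dots> = ennreal (sqrt K) * (\<integral>\<^sup>+v. f v * ?w v \<partial>lborel) * (\<integral>\<^sup>+u. g u * ?w u \<partial>lborel)"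
      by (rule nn_integral_cmult) measurable
    also have "\<dots> < \<infinity>"
      using f g by (simp add: ennreal_mult_less_top)
    finally have "AE a in lborel. indicator {a. \<bar>a\<bar> \<le> real K} a * (\<integral>\<^sup>+u. f (a * u) * g u \<partial>lborel) \<noteq> \<infinity>"
      by (intro nn_integral_PInf_AE) auto
    then show ?thesis
      by eventually_elim (auto simp: less_top)
  qed
  have "AE a in lborel. \<forall>K::nat. \<bar>a\<bar> \<le> real K \<longrightarrow> (\<integral>\<^sup>+u. f (a * u) * g u \<partial>lborel) < \<infinity>"
    unfolding AE_all_countable using box by blast
  then show ?thesis
    by eventually_elim (use real_arch_simple in blast)
qed

text \<open>With \<open>\<theta> = (cos \<tau>, sin \<tau>)\<close> and \<open>u = t * cos \<tau>\<close> this is the preceding lemma for the slope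
  \<open>- tan \<tau>\<close>.  The exceptional angles form a null set because they are covered by the zeros of the
  cosine and by countably many differentiable images, under branches of the inverse of the slope,
  of the exceptional slopes.\<close>

lemma AE_circle_measure_nn_integral_finite:
  fixes f g :: "real \<Rightarrow> ennreal"
  assumes [measurable]: "f \<in> borel_measurable borel" "g \<in> borel_measurable borel"
    and f: "(\<integral>\<^sup>+v. f v * ennreal (1 / sqrt \<bar>v\<bar>) \<partial>lborel) < \<infinity>"
    and g: "(\<integral>\<^sup>+u. g u * ennreal (1 / sqrt \<bar>u\<bar>) \<partial>lborel) < \<infinity>"
  shows "AE \<theta> in circle_measure. (\<integral>\<^sup>+t. f (- snd \<theta> * t) * g (fst \<theta> * t) \<partial>lborel) < \<infinity>"
proof -
  define I where "I \<theta> = (\<integral>\<^sup>+t. f (- snd \<theta> * t) * g (fst \<theta> * t) \<partial>lborel)" for \<theta> :: "real \<times> real"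
  define N where "N = {a. \<not> (\<integral>\<^sup>+u. f (a * u) * g u \<partial>lborel) < \<infinity>}"
  have "N \<in> sets lborel" unfolding N_def by measurable
  then have "N \<in> null_sets lborel"
    using AE_slope_nn_integral_finite[OF assms] by (subst AE_iff_null_sets) (simp_all add: N_def)
  then have N: "negligible N"
    using negligible_iff_null_sets null_sets_completionI by blast
  define E where "E k = (\<lambda>a. arctan (- a) + of_int k * pi) ` N" for k :: int
  have E: "negligible (E k)" for k
    unfolding E_def
  proof (rule negligible_differentiable_image_negligible[OF order_refl N])
    have "((\<lambda>a. arctan (- a) + of_int k * pi) has_real_derivative - inverse (1 + x\<^sup>2)) (at x within N)" for x
      by (auto intro!: derivative_eq_intros)
    then show "(\<lambda>a. arctan (- a) + of_int k * pi) differentiable_on N"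
      unfolding differentiable_on_def differentiable_def has_field_derivative_def by blast
  qed
  have bad: "negligible ((\<Union>k. E k) \<union> range (\<lambda>k::int. pi / 2 + of_int k * pi))"
  proof (rule negligible_Un)
    show "negligible (\<Union>k. E k)"
      by (rule negligible_countable_Union) (use E in auto)
    have "range (\<lambda>k::int. pi / 2 + of_int k * pi) \<in> null_sets lborel"
      by (rule countable_imp_null_set_lborel) simp
    then show "negligible (range (\<lambda>k::int. pi / 2 + of_int k * pi))"
      using negligible_iff_null_sets null_sets_completionI by blast
  qed
  have good: "I (cos \<tau>, sin \<tau>) < \<infinity>"
    if \<tau>: "\<tau> \<notin> (\<Union>k. E k) \<union> range (\<lambda>k::int. pi / 2 + of_int k * pi)" for \<tau>
  proof -
    obtain k :: int where "\<tau> = arctan (tan \<tau>) + of_int k * pi \<or> \<tau> = pi / 2 + of_int k * pi"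
      using tan_eq_arctan_Ex[of \<tau> "tan \<tau>"] by blast
    with \<tau> have k: "\<tau> = arctan (tan \<tau>) + of_int k * pi" by blast
    then have cos: "cos \<tau> \<noteq> 0"
    proof -
      have "tan \<tau> = 0" if "cos \<tau> = 0" using that by (simp add: tan_def)
      then have "sin \<tau> = 0" if "cos \<tau> = 0"
        using k that by (simp add: sin_zero_iff_int2)
      then show ?thesis using sin_zero_abs_cos_one[of \<tau>] by auto
    qed
    have "- tan \<tau> \<notin> N"
    proof
      assume "- tan \<tau> \<in> N"
      then have "\<tau> \<in> E k" unfolding E_def by (rule rev_image_eqI) (use k in simp)
      with \<tau> show False by blast
    qed
    then have fin: "(\<integral>\<^sup>+u. f (- tan \<tau> * u) * g u \<partial>lborel) < \<infinity>" by (simp add: N_def)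
    have "I (cos \<tau>, sin \<tau>) = (\<integral>\<^sup>+t. f (- tan \<tau> * (cos \<tau> * t)) * g (cos \<tau> * t) \<partial>lborel)"
      unfolding I_def using cos by (simp add: tan_def)
    also have "\<dots> = ennreal (1 / \<bar>cos \<tau>\<bar>) * (\<integral>\<^sup>+u. f (- tan \<tau> * u) * g u \<partial>lborel)"
      using cos by (intro nn_integral_dilation[where f="\<lambda>u. f (- tan \<tau> * u) * g u"]) measurable
    also have "\<dots> < \<infinity>" using fin by (simp add: ennreal_mult_less_top)
    finally show ?thesis .
  qed
  have "AE \<tau> in lborel. I (cos \<tau>, sin \<tau>) < \<infinity>"
  proof -
    have "AE \<tau> in lebesgue. \<tau> \<notin> (\<Union>k. E k) \<union> range (\<lambda>k::int. pi / 2 + of_int k * pi)"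
      using bad by (intro AE_not_in) (simp add: negligible_iff_null_sets)
    then have "AE \<tau> in lebesgue. I (cos \<tau>, sin \<tau>) < \<infinity>"
      by eventually_elim (rule good)
    then show ?thesis by (simp only: AE_completion_iff)
  qed
  then have AE: "AE \<tau> in restrict_space lborel {0..<2 * pi}. I (cos \<tau>, sin \<tau>) < \<infinity>"
    by (subst AE_restrict_space_iff) auto
  \<comment> \<open>Pushing an almost-everywhere statement forward to the circle requires the set of good directions to be Borel.\<close>
  have "(\<lambda>\<theta>. \<integral>\<^sup>+t. f (- snd \<theta> * t) * g (fst \<theta> * t) \<partial>lborel) \<in> borel_measurable (borel :: (real \<times> real) measure)"
    unfolding borel_prod[symmetric] by measurable
  then have [measurable]: "I \<in> borel_measurable (restrict_space borel (sphere 0 1))"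
    unfolding I_def by (rule measurable_restrict_space1)
  have "{\<theta> \<in> space (restrict_space borel (sphere 0 1)). I \<theta> < \<infinity>} \<in> sets (restrict_space borel (sphere 0 1))"
    by measurable
  from AE_distr_iff[OF circle_param_measurable this] AE
  have "AE \<theta> in circle_measure. I \<theta> < \<infinity>"
    unfolding circle_measure_def by simp
  then show ?thesis unfolding I_def .
qed

section \<open>Projections of product measures\<close>

lemma integral_mult_pair_prob:
  fixes f :: "'a \<Rightarrow> complex" and g :: "'b \<Rightarrow> complex"
  assumes M: "prob_space M" and N: "prob_space N"
    and [measurable]: "f \<in> borel_measurable M" "g \<in> borel_measurable N"
    and f: "\<And>x. norm (f x) \<le> 1" and g: "\<And>y. norm (g y) \<le> 1"
  shows "(\<integral>z. f (fst z) * g (snd z) \<partial>(M \<Otimes>\<^sub>M N)) = (\<integral>x. f x \<partial>M) * (\<integral>y. g y \<partial>N)"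
proof -
  interpret M: prob_space M by fact
  interpret N: prob_space N by fact
  interpret pair_prob_space M N ..
  have "integrable (M \<Otimes>\<^sub>M N) (\<lambda>z. f (fst z) * g (snd z))"
    by (rule integrable_const_bound[where B = 1])
       (auto simp: norm_mult intro!: mult_le_one f g)
  from integral_fst'[OF this] show ?thesis by simp
qed

lemma linear_proj_eq_normal_coordinate:
  fixes \<theta> y :: "real \<times> real"
  assumes "norm \<theta> = 1"
  shows "linear_proj \<theta> y = (- snd \<theta> * fst y + fst \<theta> * snd y) *\<^sub>R (- snd \<theta>, fst \<theta>)"
proof -
  obtain c s a b where eqs: "\<theta> = (c, s)" "y = (a, b)" by (cases \<theta>, cases y)
  have "c\<^sup>2 + s\<^sup>2 = 1"
    using assms by (simp add: eqs norm_Pair real_sqrt_eq_1_iff)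
  then have "a * 1 - (a * c + b * s) * c = (- s * a + c * b) * (- s)"
    "b * 1 - (a * c + b * s) * s = (- s * a + c * b) * c"
    by algebra+
  then show ?thesis
    unfolding linear_proj_eq[OF assms] by (simp add: eqs inner_prod_def algebra_simps)
qed

lemma char_distr_linear_pair:
  assumes M1: "real_distribution M1" and M2: "real_distribution M2"
  shows "char (distr (M1 \<Otimes>\<^sub>M M2) borel (\<lambda>z. \<alpha> * fst z + \<beta> * snd z)) t =
    char M1 (\<alpha> * t) * char M2 (\<beta> * t)"
proof -
  interpret M1: real_distribution M1 by fact
  interpret M2: real_distribution M2 by fact
  have "char (distr (M1 \<Otimes>\<^sub>M M2) borel (\<lambda>z. \<alpha> * fst z + \<beta> * snd z)) t =
      (CLINT z|M1 \<Otimes>\<^sub>M M2. iexp (\<alpha> * t * fst z) * iexp (\<beta> * t * snd z))"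
    unfolding char_def
    by (subst integral_distr) (auto simp: exp_add[symmetric] algebra_simps)
  also have "\<dots> = char M1 (\<alpha> * t) * char M2 (\<beta> * t)"
    unfolding char_def
    by (rule integral_mult_pair_prob)
       (auto simp: M1.prob_space_axioms M2.prob_space_axioms simp del: of_real_mult)
  finally show ?thesis .
qed

text \<open>In the coordinate along \<open>(- snd \<theta>, fst \<theta>)\<close> the projection is the law of a linear combination of
  independent variables.  Its characteristic function is integrable by assumption, and the density
  provided by Fourier inversion is transported to the line by the isometry.\<close>

lemma proj_measure_has_continuous_density:
  fixes \<theta> :: "real \<times> real"
  assumes \<theta>: "norm \<theta> = 1" and M1: "real_distribution M1" and M2: "real_distribution M2"
    and fin: "(\<integral>\<^sup>+t. ennreal (norm (char M1 (- snd \<theta> * t))) * ennreal (norm (char M2 (fst \<theta> * t))) \<partial>lborel) < \<infinity>"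
  shows "has_continuous_density (normal_line_lebesgue \<theta>) (proj_measure \<theta> (M1 \<Otimes>\<^sub>M M2))"
proof -
  interpret M1: real_distribution M1 by fact
  interpret M2: real_distribution M2 by fact
  interpret pair_prob_space M1 M2 ..
  let ?n = "(- snd \<theta>, fst \<theta>)" and ?H = "restrict_space borel (normal_hyperplane \<theta>)"
  define X where "X z = - snd \<theta> * fst z + fst \<theta> * snd z" for z :: "real \<times> real"
  have [measurable]: "X \<in> borel_measurable (M1 \<Otimes>\<^sub>M M2)" unfolding X_def by measurable
  define \<nu> where "\<nu> = distr (M1 \<Otimes>\<^sub>M M2) borel X"
  interpret \<nu>: real_distribution \<nu> unfolding \<nu>_def by (rule real_distribution_distr) measurable
  have char: "char \<nu> t = char M1 (- snd \<theta> * t) * char M2 (fst \<theta> * t)" for t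
    unfolding \<nu>_def X_def by (rule char_distr_linear_pair[OF M1 M2])
  have "integrable lborel (char \<nu>)"
    by (rule integrableI_bounded) (use fin in \<open>auto simp: char norm_mult ennreal_mult\<close>)
  then obtain f where f: "continuous_on UNIV f" "\<And>x. 0 \<le> f x" "\<nu> = density lborel (\<lambda>x. ennreal (f x))"
    using \<nu>.continuous_density_if_integrable_char by blast
  define F where "F h = f (h \<bullet> ?n)" for h
  have nn: "?n \<bullet> ?n = 1" using \<theta> by (cases \<theta>) (simp add: norm_Pair inner_prod_def power2_eq_square)
  have cont: "continuous_on UNIV F"
    unfolding F_def by (intro continuous_on_compose2[OF f(1)] continuous_intros) auto
  then have "F \<in> borel_measurable borel" by (rule borel_measurable_continuous_onI)
  then have F: "(\<lambda>h. ennreal (F h)) \<in> borel_measurable ?H"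
    by (intro measurable_restrict_space1) simp
  have line: "(\<lambda>t. t *\<^sub>R ?n) \<in> borel \<rightarrow>\<^sub>M ?H"
    using normal_line_param_measurable[of \<theta>] by simp
  have "proj_measure \<theta> (M1 \<Otimes>\<^sub>M M2) = distr (M1 \<Otimes>\<^sub>M M2) ?H (\<lambda>z. X z *\<^sub>R ?n)"
    unfolding proj_measure_def X_def
    by (intro distr_cong refl linear_proj_eq_normal_coordinate \<theta>)
  also have "\<dots> = distr \<nu> ?H (\<lambda>t. t *\<^sub>R ?n)"
    unfolding \<nu>_def by (subst distr_distr[OF line]) (auto simp: o_def)
  also have "\<dots> = distr (density lborel (\<lambda>t. ennreal (F (t *\<^sub>R ?n)))) ?H (\<lambda>t. t *\<^sub>R ?n)"
    unfolding f(3) F_def inner_scaleR_left nn by simp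
  also have "\<dots> = density (normal_line_lebesgue \<theta>) (\<lambda>h. ennreal (F h))"
    unfolding normal_line_lebesgue_def
    by (rule density_distr[symmetric, OF F normal_line_param_measurable])
  finally have eq: "proj_measure \<theta> (M1 \<Otimes>\<^sub>M M2) = density (normal_line_lebesgue \<theta>) (\<lambda>h. ennreal (F h))" .
  show ?thesis
    unfolding has_continuous_density_def
  proof (intro conjI exI[of _ F])
    show "absolutely_continuous (normal_line_lebesgue \<theta>) (proj_measure \<theta> (M1 \<Otimes>\<^sub>M M2))"
      unfolding eq using F by (intro absolutely_continuousI_density) (simp add: normal_line_lebesgue_def)
    show "continuous_on (space (normal_line_lebesgue \<theta>)) F"
      by (rule continuous_on_subset[OF cont]) simp
  qed (auto simp: F_def f(2) eq)
qed

text \<open>The one-dimensional form of decay to which the almost sure statement about projections reduces;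
  it holds as soon as the averages of \<open>\<bar>char M\<bar>\<close> over \<open>[- T, T]\<close> are smaller than
  \<open>T powr (- 1/2)\<close> by a fixed power of \<open>T\<close>.\<close>

definition inverse_sqrt_integrable_char :: "real measure \<Rightarrow> bool" where
  "inverse_sqrt_integrable_char M \<longleftrightarrow> (\<integral>\<^sup>+t. ennreal (norm (char M t)) * ennreal (1 / sqrt \<bar>t\<bar>) \<partial>lborel) < \<infinity>"

theorem AE_proj_measure_has_continuous_density:
  assumes "real_distribution M1" "real_distribution M2" "inverse_sqrt_integrable_char M1" "inverse_sqrt_integrable_char M2"
  shows "AE \<theta> in circle_measure.
    has_continuous_density (normal_line_lebesgue \<theta>) (proj_measure \<theta> (M1 \<Otimes>\<^sub>M M2))"
proof -
  interpret M1: real_distribution M1 by fact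
  interpret M2: real_distribution M2 by fact
  have "AE \<theta> in circle_measure. \<theta> \<in> space circle_measure" by simp
  then have "AE \<theta> in circle_measure. norm \<theta> = 1"
    by eventually_elim (simp add: circle_measure_def space_restrict_space)
  moreover have "AE \<theta> in circle_measure. (\<integral>\<^sup>+t. ennreal (norm (char M1 (- snd \<theta> * t))) *
      ennreal (norm (char M2 (fst \<theta> * t))) \<partial>lborel) < \<infinity>"
    using assms(3,4) unfolding inverse_sqrt_integrable_char_def
    by (intro AE_circle_measure_nn_integral_finite) auto
  ultimately show ?thesis
    by eventually_elim (rule proj_measure_has_continuous_density[OF _ assms(1,2)])
qed

section \<open>Exponential sums over consecutive digits\<close>

definition digit_char :: "nat set \<Rightarrow> real \<Rightarrow> complex" where
  "digit_char D s = (\<Sum>d\<in>D. iexp (s * real d)) / of_nat (card D)"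

lemma norm_digit_char_le_1: "norm (digit_char D s) \<le> 1"
proof -
  have "norm (\<Sum>d\<in>D. iexp (s * real d)) \<le> (\<Sum>d\<in>D. norm (iexp (s * real d)))"
    by (rule norm_sum)
  also have "\<dots> = real (card D)" by (simp del: of_real_mult)
  finally show ?thesis
    unfolding digit_char_def norm_divide by (cases "card D = 0") (simp_all add: divide_le_eq)
qed

lemma digit_char_periodic: "digit_char D (s + 2 * pi * real m) = digit_char D s"
proof -
  have "iexp ((s + 2 * pi * real m) * real d) = iexp (s * real d)" for d
  proof -
    have e: "\<i> * of_real ((s + 2 * pi * real m) * real d) =
        \<i> * of_real (s * real d) + complex_of_real (2 * real (m * d) * pi) * \<i>"
      by (simp add: algebra_simps)
    show ?thesis
      unfolding e exp_add by (subst exp_integer_2pi) simp_all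
  qed
  then show ?thesis by (simp add: digit_char_def)
qed

text \<open>For consecutive digits the sum is geometric, and \<open>\<bar>1 - iexp s\<bar> = 2 * \<bar>sin (s / 2)\<bar>\<close>.\<close>

lemma norm_digit_char_interval_le:
  assumes "sin (s / 2) \<noteq> 0" "N > 0"
  shows "norm (digit_char {1..N} s) \<le> 1 / (real N * \<bar>sin (s / 2)\<bar>)"
proof -
  let ?z = "iexp s"
  have pw: "iexp (s * real d) = ?z ^ d" for d
    by (subst exp_of_nat_mult[symmetric]) (simp add: mult_ac)
  have "(1 - ?z) * (\<Sum>d\<in>{1..N}. ?z ^ d) = ?z ^ 1 - ?z ^ Suc N"
    using assms(2) by (subst sum_gp_multiplied) auto
  then have "norm (1 - ?z) * norm (\<Sum>d\<in>{1..N}. ?z ^ d) = norm (?z ^ 1 - ?z ^ Suc N)"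
    by (metis norm_mult)
  also have "\<dots> \<le> norm (?z ^ 1) + norm (?z ^ Suc N)" by (rule norm_triangle_ineq4)
  also have "\<dots> = 2" by (simp add: norm_power norm_mult)
  also have "norm (1 - ?z) = 2 * \<bar>sin (s / 2)\<bar>"
    using dist_exp_i_1[of s] by (simp add: norm_minus_commute)
  finally have "\<bar>sin (s / 2)\<bar> * norm (\<Sum>d\<in>{1..N}. ?z ^ d) \<le> 1" by simp
  then show ?thesis
    unfolding digit_char_def pw norm_divide using assms by (simp add: field_simps)
qed

text \<open>Jordan's inequality, by concavity on \<open>[0, \<pi> / 2]\<close> and reflection in the midpoint.\<close>

lemma sin_pi_ge_min:
  assumes "0 \<le> z" "z \<le> 1"
  shows "2 * min z (1 - z) \<le> sin (pi * z)"
proof -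
  have conc: "concave_on {0..pi/2} sin"
    by (rule f''_le0_imp_concave[where f'=cos and f''="\<lambda>x. - sin x"])
      (auto intro!: derivative_eq_intros sin_ge_zero)
  have half: "2 * t \<le> sin (pi * t)" if "0 \<le> t" "t \<le> 1/2" for t
    using concave_onD[OF conc, of "2 * t" 0 "pi/2"] that by (simp add: mult.commute)
  show ?thesis
  proof (cases "z \<le> 1/2")
    case True
    then show ?thesis using half[of z] assms by simp
  next
    case False
    have "sin (pi * (1 - z)) = sin (pi * z)" by (simp add: algebra_simps sin_diff)
    then show ?thesis using half[of "1 - z"] False assms by simp
  qed
qed

lemma harm_le_1_plus_ln:
  assumes "n > 0"
  shows "harm n \<le> 1 + ln (real n)"
proof -
  obtain m where m: "n = Suc m" using assms by (cases n) auto
  have "harm (Suc m) - ln (real (Suc m)) \<le> harm (Suc 0) - ln (real (Suc 0))"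
    using decseqD[OF decseq_harm_diff_ln, of 0 m] by simp
  moreover have "harm (Suc 0) = (1 :: real)" by (simp add: harm_def)
  ultimately show ?thesis unfolding m by simp
qed

text \<open>Half the argument of the term number \<open>k\<close> is \<open>\<pi> * z\<close> with \<open>z\<close> between \<open>k / p\<close> and
  \<open>(k + 1) / p\<close>.  The two extreme terms, where \<open>\<pi> * z\<close> may be close to a zero of the sine, are
  bounded by 1.  The others are controlled by the distance from \<open>z\<close> to the nearer end of the unit
  interval, and each end contributes half a harmonic sum.\<close>

lemma sum_digit_char_le:
  assumes p: "p \<ge> 2" and N: "N > 0" and y: "0 \<le> y" "y < 2 * pi"
  shows "(\<Sum>k<p. norm (digit_char {1..N} ((y + 2 * pi * real k) / real p)))
    \<le> 2 + real p / real N * (1 + ln (real p))"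
proof -
  obtain q where q: "p = Suc (Suc q)" using p by (metis add_2_eq_Suc le_Suc_ex)
  define h where "h k = norm (digit_char {1..N} ((y + 2 * pi * real k) / real p))" for k
  have mid: "h (Suc k) \<le> real p / (2 * real N) * (1 / real (Suc k) + 1 / real (q - k))" if k: "k < q" for k
  proof -
    define z where "z = (y / (2 * pi) + real (Suc k)) / real p"
    have s: "(y + 2 * pi * real (Suc k)) / real p / 2 = pi * z"
      unfolding z_def by (simp add: distrib_left add_divide_distrib del: of_nat_Suc)
    have frac: "0 \<le> y / (2 * pi)" "y / (2 * pi) < 1" using y by simp_all
    have lo: "real (Suc k) / real p \<le> z"
      unfolding z_def using frac by (intro divide_right_mono) auto
    have "1 - z = (real p - y / (2 * pi) - real (Suc k)) / real p"
      unfolding z_def using p by (simp add: field_simps)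
    also have "\<dots> \<ge> real (q - k) / real p"
      using frac k q by (intro divide_right_mono) (auto simp: of_nat_diff)
    finally have hi: "real (q - k) / real p \<le> 1 - z" .
    have pos: "0 < real (Suc k) / real p" "0 < real (q - k) / real p" using k p by auto
    have z01: "0 < z" "z < 1" using lo hi pos by linarith+
    define w where "w = min (real (Suc k)) (real (q - k)) / real p"
    have w: "0 < w" "w \<le> real (Suc k) / real p" "w \<le> real (q - k) / real p"
      unfolding w_def using k p by (auto intro!: divide_right_mono simp del: of_nat_Suc)
    have "2 * w \<le> 2 * min z (1 - z)"
      using w lo hi by (simp only: mult_le_cancel_left_pos zero_less_numeral min.bounded_iff) linarith
    also have "\<dots> \<le> sin (pi * z)" using z01 by (intro sin_pi_ge_min) auto
    finally have sin: "2 * w \<le> sin (pi * z)" .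
    then have sin_pos: "0 < sin (pi * z)" using w(1) by linarith
    have "h (Suc k) \<le> 1 / (real N * \<bar>sin (pi * z)\<bar>)"
      unfolding h_def using norm_digit_char_interval_le[OF _ N, of "(y + 2 * pi * real (Suc k)) / real p"]
      using sin_pos unfolding s by simp
    also have "\<dots> = 1 / (real N * sin (pi * z))" using sin_pos by simp
    also have "\<dots> \<le> 1 / (real N * (2 * w))"
      using sin sin_pos w(1) N by (intro divide_left_mono mult_left_mono mult_pos_pos) auto
    also have "\<dots> = real p / (2 * real N) * (1 / min (real (Suc k)) (real (q - k)))"
      by (simp add: w_def)
    also have "\<dots> \<le> real p / (2 * real N) * (1 / real (Suc k) + 1 / real (q - k))"
      by (rule mult_left_mono) (use k in \<open>simp_all add: min_def\<close>)
    finally show ?thesis .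
  qed
  have "(\<Sum>k<p. h k) = h 0 + (\<Sum>k<q. h (Suc k)) + h (Suc q)"
    unfolding q sum.lessThan_Suc[of h "Suc q"] sum.lessThan_Suc_shift[of h q] ..
  also have "\<dots> \<le> 1 + (\<Sum>k<q. real p / (2 * real N) * (1 / real (Suc k) + 1 / real (q - k))) + 1"
    by (intro add_mono sum_mono mid) (auto simp: h_def norm_digit_char_le_1)
  also have "(\<Sum>k<q. real p / (2 * real N) * (1 / real (Suc k) + 1 / real (q - k))) =
      real p / (2 * real N) * ((\<Sum>k<q. 1 / real (Suc k)) + (\<Sum>k<q. 1 / real (q - k)))"
    by (simp only: sum_distrib_left[symmetric] sum.distrib)
  also have "(\<Sum>k<q. 1 / real (q - k)) = (\<Sum>k<q. 1 / real (Suc k))"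
    by (rule sum.reindex_bij_witness[of _ "\<lambda>k. q - Suc k" "\<lambda>k. q - Suc k"])
       (auto simp: of_nat_diff)
  also have "(\<Sum>k<q. 1 / real (Suc k)) = harm q"
    by (simp add: harm_altdef inverse_eq_divide)
  also have "real p / (2 * real N) * (harm q + harm q) = real p / real N * harm q" by simp
  finally have "(\<Sum>k<p. h k) \<le> 1 + real p / real N * harm q + 1" .
  moreover have "real p / real N * harm q \<le> real p / real N * (1 + ln (real p))"
  proof (rule mult_left_mono)
    show "harm q \<le> 1 + ln (real p)"
    proof (cases "q = 0")
      case True
      then show ?thesis using p by (simp add: harm_def)
    next
      case False
      have "ln (real q) \<le> ln (real p)" using False q by simp
      then show ?thesis using harm_le_1_plus_ln[of q] False by simp
    qed
  qed simp
  ultimately show ?thesis unfolding h_def by linarith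
qed

section \<open>Self-similarity of missing digits measures\<close>

text \<open>The self-similarity of the measure: prepending an independent digit to a digit sequence
  reproduces the law of the sequence, and it acts on the sum by
  \<open>x \<mapsto> (d + x) / p\<close>.\<close>

theorem char_missing_digits_measure_scaling:
  assumes p: "p \<ge> 2" and D: "D \<noteq> {}" "finite D"
  shows "char (missing_digits_measure p D) t =
    digit_char D (t / real p) * char (missing_digits_measure p D) (t / real p)"
proof -
  define M where "M = measure_pmf (pmf_of_set D)"
  define X where "X = (\<lambda>d :: nat \<Rightarrow> nat. \<Sum>i. real (d i) / real p ^ Suc i)"
  interpret M: prob_space M unfolding M_def by (rule prob_space_measure_pmf)
  interpret sequence_space M ..
  have S: "prob_space S" by (intro prob_space_PiM M.prob_space_axioms)
  interpret MS: pair_prob_space M S ..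
  have X[measurable]: "X \<in> borel_measurable S"
    using digit_sum_measurable[of p D] unfolding X_def M_def .
  have char_eq: "char (missing_digits_measure p D) u = (CLINT d|S. iexp (u * X d))" for u
    unfolding char_def missing_digits_measure_def
    by (subst integral_distr) (use digit_sum_measurable[of p D] in \<open>auto simp: X_def M_def\<close>)
  have iter[measurable]: "(\<lambda>(s, \<omega>). case_nat s \<omega>) \<in> M \<Otimes>\<^sub>M S \<rightarrow>\<^sub>M S"
    by measurable
  have "AE \<omega> in S. \<omega> i \<in> D" for i
  proof -
    have "AE d in M. d \<in> D" unfolding M_def using D by (simp add: AE_measure_pmf_iff)
    then show ?thesis by (intro AE_component) auto
  qed
  then have "AE \<omega> in S. \<forall>i. \<omega> i \<in> D" by (simp add: AE_all_countable)
  \<comment> \<open>Splitting off the first term needs a convergent series, hence bounded digits.\<close>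
  then have split: "AE \<omega> in S. \<forall>s. X (case_nat s \<omega>) = real s / real p + X \<omega> / real p"
  proof eventually_elim
    case (elim \<omega>)
    have summable: "summable (\<lambda>i. real (\<omega> i) / real p ^ Suc i)"
    proof (rule summable_comparison_test')
      show "summable (\<lambda>i. real (Max D) * (1 / real p) ^ Suc i)"
        using p by (intro summable_mult summable_Suc_iff[THEN iffD2] summable_geometric) auto
      show "norm (real (\<omega> n) / real p ^ Suc n) \<le> real (Max D) * (1 / real p) ^ Suc n" for n
        using Max_ge[OF D(2), of "\<omega> n"] elim
        by (simp add: power_one_over divide_right_mono)
    qed
    show ?case
    proof
      fix s
      let ?f = "\<lambda>i. real (case_nat s \<omega> i) / real p ^ Suc i"
      have tail: "?f (Suc i) = real (\<omega> i) / real p ^ Suc i / real p" for i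
        by simp
      have "summable (\<lambda>i. ?f (Suc i))"
        unfolding tail by (rule summable_divide[OF summable])
      then have "summable ?f" by (rule summable_Suc_iff[of ?f, THEN iffD1])
      from suminf_split_head[OF this]
      have "X (case_nat s \<omega>) = ?f 0 + (\<Sum>i. ?f (Suc i))"
        unfolding X_def by linarith
      also have "\<dots> = real s / real p + (\<Sum>i. real (\<omega> i) / real p ^ Suc i / real p)"
        unfolding tail by simp
      also have "\<dots> = real s / real p + X \<omega> / real p"
        unfolding X_def by (simp only: suminf_divide[OF summable])
      finally show "X (case_nat s \<omega>) = real s / real p + X \<omega> / real p" .
    qed
  qed
  have split': "AE z in M \<Otimes>\<^sub>M S. X (case_nat (fst z) (snd z)) = real (fst z) / real p + X (snd z) / real p"
  proof (rule MS.AE_pair_measure)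
    have [measurable]: "(\<lambda>z. real (fst z)) \<in> borel_measurable (M \<Otimes>\<^sub>M S)"
      by (rule measurable_compose[OF measurable_fst]) (simp add: M_def)
    show "{z \<in> space (M \<Otimes>\<^sub>M S). X (case_nat (fst z) (snd z)) = real (fst z) / real p + X (snd z) / real p}
        \<in> sets (M \<Otimes>\<^sub>M S)"
      by measurable
  qed (use split in \<open>auto elim: eventually_mono\<close>)
  have "char (missing_digits_measure p D) t =
      (CLINT d|distr (M \<Otimes>\<^sub>M S) S (\<lambda>(s, \<omega>). case_nat s \<omega>). iexp (t * X d))"
    by (simp only: char_eq PiM_iter)
  also have "\<dots> = (CLINT z|M \<Otimes>\<^sub>M S. iexp (t * X (case_nat (fst z) (snd z))))"
    by (subst integral_distr) (auto simp: case_prod_beta)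
  also have "\<dots> = (CLINT z|M \<Otimes>\<^sub>M S. iexp (t / real p * real (fst z)) * iexp (t / real p * X (snd z)))"
  proof (rule integral_cong_AE)
    show "AE z in M \<Otimes>\<^sub>M S. iexp (t * X (case_nat (fst z) (snd z))) =
        iexp (t / real p * real (fst z)) * iexp (t / real p * X (snd z))"
      using split' by eventually_elim (simp add: exp_add[symmetric] field_simps add_divide_distrib)
    have "(\<lambda>z. real (fst z)) \<in> borel_measurable (M \<Otimes>\<^sub>M S)"
      by (rule measurable_compose[OF measurable_fst]) (simp add: M_def)
    then show "(\<lambda>z. iexp (t / real p * real (fst z)) * iexp (t / real p * X (snd z))) \<in> borel_measurable (M \<Otimes>\<^sub>M S)"
      by measurable
  qed measurable
  also have "\<dots> = (CLINT s|M. iexp (t / real p * real s)) * (CLINT \<omega>|S. iexp (t / real p * X \<omega>))"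
  proof (rule integral_mult_pair_prob)
    show "(\<lambda>s. iexp (t / real p * real s)) \<in> borel_measurable M" by (simp add: M_def)
    show "(\<lambda>\<omega>. iexp (t / real p * X \<omega>)) \<in> borel_measurable S" by measurable
  qed (simp_all add: M.prob_space_axioms S del: of_real_mult of_real_divide)
  also have "(CLINT s|M. iexp (t / real p * real s)) = digit_char D (t / real p)"
    unfolding M_def digit_char_def using D
    by (subst integral_measure_pmf[of D]) (auto simp: sum_divide_distrib scaleR_conv_of_real field_simps)
  finally show ?thesis by (simp add: char_eq)
qed

section \<open>Averaged Fourier decay from self-similarity\<close>

text \<open>Write \<open>k = m * p + r\<close> with \<open>r < p\<close>.  By periodicity the factor \<open>h\<close> depends only on \<open>r\<close>, while the
  other factor is evaluated at the translates by \<open>2 * pi * m\<close> of the point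
  \<open>(y + 2 * pi * r) / p\<close>, which again lies in \<open>[0, 2\<pi>)\<close>.  So the sum over \<open>m\<close> is bounded by
  induction and the sum over \<open>r\<close> by \<open>S\<close>.\<close>

lemma sum_translates_le_power:
  fixes \<phi> h :: "real \<Rightarrow> real"
  assumes p: "p > 0"
    and scaling: "\<And>t. \<phi> t = h (t / real p) * \<phi> (t / real p)"
    and periodic: "\<And>s m. h (s + 2 * pi * real m) = h s"
    and \<phi>: "\<And>t. \<phi> t \<le> 1" and h: "\<And>s. 0 \<le> h s"
    and S: "\<And>y. 0 \<le> y \<Longrightarrow> y < 2 * pi \<Longrightarrow> (\<Sum>r<p. h ((y + 2 * pi * real r) / real p)) \<le> S"
    and y: "0 \<le> y" "y < 2 * pi"
  shows "(\<Sum>k<p ^ n. \<phi> (y + 2 * pi * real k)) \<le> S ^ n"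
  using y
proof (induction n arbitrary: y)
  case (Suc n)
  have S0: "0 \<le> S"
    by (rule order_trans[OF _ S[of 0]]) (auto intro: sum_nonneg h)
  let ?s = "\<lambda>r. (y + 2 * pi * real r) / real p"
  have s: "0 \<le> ?s r" "?s r < 2 * pi" if "r < p" for r
  proof -
    have "y + 2 * pi * real r < 2 * pi * (real r + 1)" using Suc.prems by (simp add: algebra_simps)
    also have "\<dots> \<le> 2 * pi * real p" using that by (intro mult_left_mono) auto
    finally show "?s r < 2 * pi" using p by (simp add: field_simps)
  qed (use Suc.prems in auto)
  have eq: "\<phi> (y + 2 * pi * real (m * p + r)) = h (?s r) * \<phi> (?s r + 2 * pi * real m)" for m r
  proof -
    have "(y + 2 * pi * real (m * p + r)) / real p = ?s r + 2 * pi * real m"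
      using p by (simp add: field_simps)
    then show ?thesis by (subst scaling) (simp only: periodic)
  qed
  have "(\<Sum>k<p ^ Suc n. \<phi> (y + 2 * pi * real k)) =
      (\<Sum>m<p ^ n. \<Sum>k=m * p..<m * p + p. \<phi> (y + 2 * pi * real k))"
    by (subst sum.nat_group) (simp add: mult.commute)
  also have "\<dots> = (\<Sum>m<p ^ n. \<Sum>r<p. \<phi> (y + 2 * pi * real (m * p + r)))"
  proof (rule sum.cong[OF refl])
    fix m
    show "(\<Sum>k=m * p..<m * p + p. \<phi> (y + 2 * pi * real k)) = (\<Sum>r<p. \<phi> (y + 2 * pi * real (m * p + r)))"
      by (rule sum.reindex_bij_witness[of _ "\<lambda>r. m * p + r" "\<lambda>k. k - m * p"]) auto
  qed
  also have "\<dots> = (\<Sum>r<p. \<Sum>m<p ^ n. \<phi> (y + 2 * pi * real (m * p + r)))"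
    by (rule sum.swap)
  also have "\<dots> = (\<Sum>r<p. h (?s r) * (\<Sum>m<p ^ n. \<phi> (?s r + 2 * pi * real m)))"
    unfolding eq by (simp only: sum_distrib_left)
  also have "\<dots> \<le> (\<Sum>r<p. h (?s r) * S ^ n)"
    by (intro sum_mono mult_left_mono Suc.IH s h) auto
  also have "\<dots> = (\<Sum>r<p. h (?s r)) * S ^ n" by (simp only: sum_distrib_right)
  also have "\<dots> \<le> S * S ^ n"
    using Suc.prems by (intro mult_right_mono S zero_le_power S0) auto
  finally show ?case by simp
next
  case 0
  show ?case using \<phi>[of y] by (simp only: power_0 lessThan_Suc lessThan_0 One_nat_def) simp
qed

lemma nn_integral_eq_sum_translates:
  fixes f :: "real \<Rightarrow> ennreal"
  assumes [measurable]: "f \<in> borel_measurable borel" and L: "0 \<le> L"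
  shows "(\<integral>\<^sup>+t. f t * indicator {0..<L * real m} t \<partial>lborel) =
    (\<integral>\<^sup>+y. (\<Sum>k<m. f (y + L * real k)) * indicator {0..<L} y \<partial>lborel)"
proof (induction m)
  case (Suc m)
  have "(\<integral>\<^sup>+t. f t * indicator {0..<L * real (Suc m)} t \<partial>lborel) =
      (\<integral>\<^sup>+t. f t * indicator {0..<L * real m} t + f t * indicator {L * real m..<L * real (Suc m)} t \<partial>lborel)"
  proof (intro nn_integral_cong)
    fix t :: real
    have "0 \<le> L * real m" "L * real m \<le> L * real (Suc m)" using L by (auto intro: mult_left_mono)
    then show "f t * indicator {0..<L * real (Suc m)} t =
        f t * indicator {0..<L * real m} t + f t * indicator {L * real m..<L * real (Suc m)} t"
      by (auto split: split_indicator simp del: of_nat_Suc)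
  qed
  also have "\<dots> = (\<integral>\<^sup>+t. f t * indicator {0..<L * real m} t \<partial>lborel) +
      (\<integral>\<^sup>+t. f t * indicator {L * real m..<L * real (Suc m)} t \<partial>lborel)"
    by (intro nn_integral_add) measurable
  also have "(\<integral>\<^sup>+t. f t * indicator {L * real m..<L * real (Suc m)} t \<partial>lborel) =
      (\<integral>\<^sup>+y. f (y + L * real m) * indicator {0..<L} y \<partial>lborel)"
    by (subst nn_integral_real_affine[where c=1 and t="L * real m"])
       (auto intro!: nn_integral_cong simp: algebra_simps split: split_indicator)
  finally show ?case
    unfolding Suc.IH
    by (subst (asm) nn_integral_add[symmetric]) (auto simp: distrib_right)
qed simp

lemma nn_integral_inverse_sqrt_finite:
  assumes "0 \<le> c"
  shows "(\<integral>\<^sup>+u. ennreal (1 / sqrt u) * indicator {0..c} u \<partial>lborel) < \<infinity>"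
proof -
  have "(\<integral>\<^sup>+u. ennreal (u powr (-1/2)) * indicator {0..c} u \<partial>lborel) = ennreal (c powr (-1/2 + 1) / (-1/2 + 1))"
    using assms by (intro nn_integral_has_integral_lebesgue' has_integral_powr_from_0) auto
  moreover have "ennreal (1 / sqrt u) * indicator {0..c} u = ennreal (u powr (-1/2)) * indicator {0..c} u" for u
    by (auto split: split_indicator simp: powr_minus_divide powr_half_sqrt)
  ultimately show ?thesis by simp
qed

text \<open>On \<open>[2\<pi>p^n, 2\<pi>p^(n+1))\<close> the weight is at most \<open>1 / sqrt (2\<pi>p^n)\<close> and the function has integral at
  most \<open>2\<pi>S^(n+1)\<close>, so these blocks contribute a geometric series.  Near the origin the function is
  bounded and the singularity of the weight is integrable.\<close>

lemma weighted_nn_integral_finite: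
  fixes \<phi> :: "real \<Rightarrow> real"
  assumes [measurable]: "\<phi> \<in> borel_measurable borel"
    and \<phi>: "\<And>t. 0 \<le> \<phi> t" "\<And>t. \<phi> t \<le> 1" and even: "\<And>t. \<phi> (- t) = \<phi> t"
    and p: "p \<ge> 2" and S: "0 \<le> S" "S < sqrt (real p)"
    and sum: "\<And>n y. 0 \<le> y \<Longrightarrow> y < 2 * pi \<Longrightarrow> (\<Sum>k<p ^ n. \<phi> (y + 2 * pi * real k)) \<le> S ^ n"
  shows "(\<integral>\<^sup>+t. ennreal (\<phi> t) * ennreal (1 / sqrt \<bar>t\<bar>) \<partial>lborel) < \<infinity>"
proof -
  define b where "b n = 2 * pi * real (p ^ n)" for n
  have b: "0 < b n" for n using p by (simp add: b_def)
  have block: "(\<integral>\<^sup>+t. ennreal (\<phi> t) * indicator {0..<b n} t \<partial>lborel) \<le> ennreal (2 * pi * S ^ n)" for n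
  proof -
    have "(\<integral>\<^sup>+t. ennreal (\<phi> t) * indicator {0..<b n} t \<partial>lborel) =
        (\<integral>\<^sup>+y. (\<Sum>k<p ^ n. ennreal (\<phi> (y + 2 * pi * real k))) * indicator {0..<2 * pi} y \<partial>lborel)"
      unfolding b_def by (rule nn_integral_eq_sum_translates) auto
    also have "\<dots> \<le> (\<integral>\<^sup>+y. ennreal (S ^ n) * indicator {0..<2 * pi} y \<partial>lborel)"
      by (intro nn_integral_mono) (auto simp: sum_ennreal \<phi> intro!: ennreal_leI sum split: split_indicator)
    also have "\<dots> = ennreal (2 * pi * S ^ n)"
      using S by (simp add: nn_integral_cmult_indicator mult.commute flip: ennreal_mult)
    finally show ?thesis .
  qed
  define c where "c n = ennreal (1 / sqrt (b n))" for n
  let ?F = "\<lambda>t. ennreal (\<phi> t) * ennreal (1 / sqrt \<bar>t\<bar>)"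
  \<comment> \<open>A block may be enlarged to the left down to the origin, so that the bound for \<open>[0, b (n + 1))\<close> applies.\<close>
  have "(\<integral>\<^sup>+t. ?F t * indicator {0..} t \<partial>lborel) \<le>
      (\<integral>\<^sup>+t. ennreal (1 / sqrt t) * indicator {0..2 * pi} t +
        (\<Sum>n. c n * (ennreal (\<phi> t) * indicator {0..<b (Suc n)} t)) \<partial>lborel)"
  proof (intro nn_integral_mono)
    fix t :: real
    consider "t < 0" | "0 \<le> t" "t \<le> 2 * pi" | "2 * pi < t" by linarith
    then show "?F t * indicator {0..} t \<le> ennreal (1 / sqrt t) * indicator {0..2 * pi} t +
        (\<Sum>n. c n * (ennreal (\<phi> t) * indicator {0..<b (Suc n)} t))"
    proof cases
      case 2
      have "?F t \<le> 1 * ennreal (1 / sqrt \<bar>t\<bar>)"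
        by (intro mult_right_mono) (use \<phi>(2)[of t] in \<open>auto simp: ennreal_le_1\<close>)
      then show ?thesis using 2 by (simp add: add_increasing2)
    next
      case 3
      have "\<exists>n. t < b n"
      proof -
        obtain n where "t / (2 * pi) < real p ^ n"
          using real_arch_pow[of "real p"] p by auto
        then show ?thesis by (auto simp: b_def field_simps)
      qed
      define m where "m = (LEAST n. t < b n)"
      have m: "t < b m" unfolding m_def using \<open>\<exists>n. t < b n\<close> by (rule LeastI_ex)
      then have "m \<noteq> 0" using 3 by (auto simp: b_def intro: Suc_leI gr0I)
      then obtain n where n: "m = Suc n" by (cases m) auto
      then have "\<not> t < b n" using not_less_Least[of n "\<lambda>n. t < b n"] unfolding m_def by auto
      then have "1 / sqrt \<bar>t\<bar> \<le> 1 / sqrt (b n)" using b[of n] by (intro divide_left_mono) auto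
      then have "?F t \<le> ennreal (\<phi> t) * c n"
        unfolding c_def by (intro mult_left_mono ennreal_leI) auto
      also have "\<dots> = c n * (ennreal (\<phi> t) * indicator {0..<b (Suc n)} t)"
        using m n 3 by (simp add: mult.commute less_imp_le[OF less_trans[OF _ 3]])
      also have "\<dots> \<le> (\<Sum>n. c n * (ennreal (\<phi> t) * indicator {0..<b (Suc n)} t))"
        using sum_le_suminf[of "\<lambda>n. c n * (ennreal (\<phi> t) * indicator {0..<b (Suc n)} t)" "{n}"] by auto
      finally show ?thesis using 3 by (auto split: split_indicator)
    qed auto
  qed
  also have "\<dots> = (\<integral>\<^sup>+t. ennreal (1 / sqrt t) * indicator {0..2 * pi} t \<partial>lborel) +
      (\<Sum>n. c n * (\<integral>\<^sup>+t. ennreal (\<phi> t) * indicator {0..<b (Suc n)} t \<partial>lborel))"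
    by (simp add: nn_integral_add nn_integral_suminf nn_integral_cmult)
  also have "\<dots> < \<infinity>"
  proof -
    define C where "C = 2 * pi * S / sqrt (2 * pi)"
    have C: "0 \<le> C" using S by (simp add: C_def)
    define r where "r = S / sqrt (real p)"
    have r: "0 \<le> r" "r < 1" using S p by (auto simp: r_def)
    have "(\<Sum>n. c n * (\<integral>\<^sup>+t. ennreal (\<phi> t) * indicator {0..<b (Suc n)} t \<partial>lborel)) \<le>
        (\<Sum>n. ennreal (C * r ^ n))"
    proof (intro suminf_le)
      fix n
      have "c n * (\<integral>\<^sup>+t. ennreal (\<phi> t) * indicator {0..<b (Suc n)} t \<partial>lborel) \<le> c n * ennreal (2 * pi * S ^ Suc n)"
        by (intro mult_left_mono block) auto
      also have "\<dots> = ennreal (1 / sqrt (b n) * (2 * pi * S ^ Suc n))"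
        unfolding c_def using b[of n] S by (intro ennreal_mult[symmetric]) auto
      also have "1 / sqrt (b n) * (2 * pi * S ^ Suc n) = C * r ^ n"
        by (simp add: b_def r_def C_def real_sqrt_mult real_sqrt_power power_divide)
      finally show "c n * (\<integral>\<^sup>+t. ennreal (\<phi> t) * indicator {0..<b (Suc n)} t \<partial>lborel) \<le>
        ennreal (C * r ^ n)" .
    qed auto
    also have "\<dots> < \<infinity>"
    proof -
      have "summable (\<lambda>n. C * r ^ n)"
        using r by (intro summable_mult summable_geometric) auto
      then have "(\<Sum>n. ennreal (C * r ^ n)) \<noteq> top"
        using r C by (intro ennreal_suminf_neq_top) auto
      then show ?thesis by (simp add: less_top)
    qed
    finally show ?thesis using nn_integral_inverse_sqrt_finite[of "2 * pi"] by simp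
  qed
  finally have half: "(\<integral>\<^sup>+t. ?F t * indicator {0..} t \<partial>lborel) < \<infinity>" .
  have "(\<integral>\<^sup>+t. ?F t * indicator {..0} t \<partial>lborel) = (\<integral>\<^sup>+t. ?F t * indicator {0..} t \<partial>lborel)"
    by (subst nn_integral_real_affine[where c="-1" and t=0])
       (auto intro!: nn_integral_cong simp: even split: split_indicator)
  moreover have "(\<integral>\<^sup>+t. ?F t \<partial>lborel) \<le> (\<integral>\<^sup>+t. ?F t * indicator {0..} t + ?F t * indicator {..0} t \<partial>lborel)"
    by (intro nn_integral_mono) (auto split: split_indicator)
  moreover have "\<dots> = (\<integral>\<^sup>+t. ?F t * indicator {0..} t \<partial>lborel) + (\<integral>\<^sup>+t. ?F t * indicator {..0} t \<partial>lborel)"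
    by (intro nn_integral_add) measurable
  ultimately show ?thesis using half by (auto simp: less_top[symmetric] top_unique)
qed

lemma real_distribution_missing_digits_measure: "real_distribution (missing_digits_measure p D)"
  by (simp add: real_distribution_def real_distribution_axioms_def prob_space_missing_digits_measure)
     (simp add: missing_digits_measure_def)

text \<open>The bound for the digit sums serves as the growth rate \<open>S\<close> of the translated sums, and the
  hypothesis makes it smaller than \<open>sqrt p\<close>, the factor by which the weight decreases from one
  block to the next.\<close>

theorem inverse_sqrt_integrable_char_missing_digits_measure:
  assumes p: "p \<ge> 2" and N: "N > 0"
    and large: "2 + real p / real N * (1 + ln (real p)) < sqrt (real p)"
  shows "inverse_sqrt_integrable_char (missing_digits_measure p {1..N})"
proof -
  let ?M = "missing_digits_measure p {1..N}"
  interpret real_distribution ?M by (rule real_distribution_missing_digits_measure)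
  show ?thesis
    unfolding inverse_sqrt_integrable_char_def
  proof (rule weighted_nn_integral_finite[OF _ _ _ _ p _ large])
    show "norm (char ?M (- t)) = norm (char ?M t)" for t
    proof -
      have "char ?M (- t) = cnj (char ?M t)"
        unfolding char_def by (subst Bochner_Integration.integral_cnj[symmetric]) (simp add: exp_cnj)
      then show ?thesis by simp
    qed
    show "0 \<le> 2 + real p / real N * (1 + ln (real p))"
      using p by (intro add_nonneg_nonneg mult_nonneg_nonneg) auto
    show "(\<Sum>k<p ^ n. norm (char ?M (y + 2 * pi * real k))) \<le> (2 + real p / real N * (1 + ln (real p))) ^ n"
      if "0 \<le> y" "y < 2 * pi" for n y
    proof (rule sum_translates_le_power[OF _ _ _ _ _ _ that])
      show "norm (char ?M t) = norm (digit_char {1..N} (t / real p)) * norm (char ?M (t / real p))" for t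
        by (subst char_missing_digits_measure_scaling) (use p N in \<open>auto simp: norm_mult\<close>)
      show "(\<Sum>r<p. norm (digit_char {1..N} ((y + 2 * pi * real r) / real p))) \<le> 2 + real p / real N * (1 + ln (real p))"
        if "0 \<le> y" "y < 2 * pi" for y
        by (rule sum_digit_char_le[OF p N that])
    qed (use p in \<open>auto simp: digit_char_periodic cmod_char_le_1 simp del: One_nat_def\<close>)
  qed (auto simp: cmod_char_le_1 simp del: One_nat_def)
qed

section \<open>Sparse digit sets in large bases\<close>

text \<open>Here \<open>p / N = b^4995\<close> and \<open>sqrt p = b^5000\<close>, so that the logarithm has to be beaten by \<open>b^5\<close>.
  The crude estimates \<open>ln b \<le> b - 1\<close> and \<open>10000 \<le> b^4\<close> suffice and even leave room
  for the additive constants.\<close>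

lemma inverse_sqrt_integrable_char_sparse_digits:
  assumes b: "b \<ge> 10"
  shows "inverse_sqrt_integrable_char (missing_digits_measure (b ^ 10000) {1..b ^ 5005})"
proof (rule inverse_sqrt_integrable_char_missing_digits_measure)
  have b1: "1 \<le> real b" using b by simp
  show "b ^ 5005 > 0" using b by simp
  have "2 \<le> b ^ 1" using b by simp
  also have "\<dots> \<le> b ^ 10000" using b by (intro power_increasing) auto
  finally show "b ^ 10000 \<ge> 2" .
  have quot: "real (b ^ 10000) / real (b ^ 5005) = real b ^ 4995"
  proof -
    have split: "real b ^ 10000 = real b ^ 4995 * real b ^ 5005" by (simp flip: power_add)
    have "real b ^ 5005 \<noteq> 0" using b by simp
    then show ?thesis unfolding of_nat_power split by (rule nonzero_mult_div_cancel_right)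
  qed
  have root: "sqrt (real (b ^ 10000)) = real b ^ 5000"
  proof -
    have "(real b ^ 5000)\<^sup>2 = real b ^ 10000" by (simp flip: power_mult)
    then show ?thesis unfolding of_nat_power by (rule real_sqrt_unique) simp
  qed
  have "ln (real (b ^ 10000)) = 10000 * ln (real b)" using b by (simp add: ln_realpow)
  also have "\<dots> \<le> 10 ^ 4 * (real b - 1)" using b ln_le_minus_one[of "real b"] by simp
  also have "\<dots> \<le> real b ^ 4 * (real b - 1)" using b by (intro mult_right_mono power_mono) auto
  also have "\<dots> = real b ^ 5 - real b ^ 4" by (simp add: eval_nat_numeral algebra_simps)
  finally have ln: "1 + ln (real (b ^ 10000)) \<le> real b ^ 5 - real b ^ 4 + 1"
    by linarith
  have "10 ^ 4 \<le> real b ^ 4" using b by (intro power_mono) auto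
  then have b4: "real b ^ 4 \<ge> 4" by simp
  have one: "1 \<le> real b ^ 4995" using b1 by (rule one_le_power)
  have "2 + real (b ^ 10000) / real (b ^ 5005) * (1 + ln (real (b ^ 10000)))
      \<le> 2 + real b ^ 4995 * (real b ^ 5 - real b ^ 4 + 1)"
    unfolding quot using ln by (intro add_left_mono mult_left_mono) auto
  also have "\<dots> < 3 * real b ^ 4995 + real b ^ 4995 * (real b ^ 5 - real b ^ 4 + 1)"
    using one by linarith
  also have "\<dots> = real b ^ 4995 * (real b ^ 5 - (real b ^ 4 - 4))"
    by (simp only: algebra_simps) 
  also have "\<dots> \<le> real b ^ 4995 * real b ^ 5"
    using b4 by (intro mult_left_mono) auto
  also have "\<dots> = real b ^ 5000" by (simp flip: power_add)
  finally show "2 + real (b ^ 10000) / real (b ^ 5005) * (1 + ln (real (b ^ 10000))) < sqrt (real (b ^ 10000))"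
    unfolding root .
qed

theorem theoremB:
  fixes lam1 lam2 :: "real measure"
  assumes "lam1 = missing_digits_measure (10 ^ 10000) {1..10 ^ 5005}"
    and "lam2 = missing_digits_measure (11 ^ 10000) {1..11 ^ 5005}"
  shows "AE \<theta> in circle_measure.
           has_continuous_density (normal_line_lebesgue \<theta>) (proj_measure \<theta> (lam1 \<Otimes>\<^sub>M lam2)) \<and>
           has_continuous_density (normal_line_lebesgue \<theta>) (proj_measure \<theta> (lam1 \<Otimes>\<^sub>M lam1))"
proof -
  have tame: "inverse_sqrt_integrable_char lam1" "inverse_sqrt_integrable_char lam2"
    unfolding assms by (rule inverse_sqrt_integrable_char_sparse_digits, simp)+
  have rd: "real_distribution lam1" "real_distribution lam2"
    unfolding assms by (rule real_distribution_missing_digits_measure)+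
  show ?thesis
    using AE_proj_measure_has_continuous_density[OF rd tame]
      AE_proj_measure_has_continuous_density[OF rd(1) rd(1) tame(1) tame(1)]
    by (rule AE_conjI)
qed

end
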